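(* Let $X$ and $Y$ be locally compact Hausdorff spaces, and let $\Phi\colon S(C_0(X))^+\to S(C_0(Y))^+$ be a surjective isometry, i.e. a surjective map with $\|\Phi(f)-\Phi(g)\|_\infty=\|f-g\|_\infty$ for all $f,g\in S(C_0(X))^+$. Then $\Phi$ extends uniquely to a surjective real-linear isometry from $C_0(X)$ onto $C_0(Y)$; that is, there is exactly one surjective real-linear isometry $\tilde\Phi\colon C_0(X)\to C_0(Y)$ with $\tilde\Phi(f)=\Phi(f)$ for all $f\in S(C_0(X))^+$.
   Context: For a locally compact Hausdorff space $K$, $C_0(K)$ denotes the real Banach space of all continuous real-valued functions on $K$ that vanish at infinity, equipped with the supremum norm $\|\cdot\|_\infty$. The positive unit sphere of $C_0(K)$ is $S(C_0(K))^+=\{f\in C_0(K):\|f\|_\infty=1,\ f\ge 0\}$, where $f \geq 0$ is meant pointwise. *)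

theory Defs
  imports "HOL-Analysis.Analysis"
begin

text \<open>
  Spaces are carrier-based (type \<open>'a topology\<close>), so that the empty space is included.
  Accordingly a function on \<open>K\<close> is represented by its \<open>extensional\<close> representative, i.e. it is
  \<open>undefined\<close> off \<open>topspace K\<close>; this makes equality of functions on \<open>K\<close> equality in HOL.
\<close>

definition C0 :: "'a topology \<Rightarrow> ('a \<Rightarrow> real) set" where
  "C0 K = {f \<in> extensional (topspace K).
             continuous_map K euclideanreal f \<and>
             (\<forall>e>0. \<exists>C. compactin K C \<and> (\<forall>x \<in> topspace K - C. \<bar>f x\<bar> < e))}"

definition c0_add :: "'a topology \<Rightarrow> ('a \<Rightarrow> real) \<Rightarrow> ('a \<Rightarrow> real) \<Rightarrow> 'a \<Rightarrow> real" where
  "c0_add K f g = (\<lambda>x\<in>topspace K. f x + g x)"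

definition c0_diff :: "'a topology \<Rightarrow> ('a \<Rightarrow> real) \<Rightarrow> ('a \<Rightarrow> real) \<Rightarrow> 'a \<Rightarrow> real" where
  "c0_diff K f g = (\<lambda>x\<in>topspace K. f x - g x)"

definition c0_scale :: "'a topology \<Rightarrow> real \<Rightarrow> ('a \<Rightarrow> real) \<Rightarrow> 'a \<Rightarrow> real" where
  "c0_scale K a f = (\<lambda>x\<in>topspace K. a * f x)"

text \<open>The case split is needed because \<open>Sup {}\<close> is unspecified on the reals.\<close>

definition supnorm :: "'a topology \<Rightarrow> ('a \<Rightarrow> real) \<Rightarrow> real" where
  "supnorm K f = (if topspace K = {} then 0 else (SUP x\<in>topspace K. \<bar>f x\<bar>))"

definition pos_sphere :: "'a topology \<Rightarrow> ('a \<Rightarrow> real) set" where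
  "pos_sphere K = {f \<in> C0 K. supnorm K f = 1 \<and> (\<forall>x\<in>topspace K. 0 \<le> f x)}"

definition isometry_on ::
  "'a topology \<Rightarrow> 'b topology \<Rightarrow> ('a \<Rightarrow> real) set \<Rightarrow> (('a \<Rightarrow> real) \<Rightarrow> ('b \<Rightarrow> real)) \<Rightarrow> bool" where
  "isometry_on X Y A T \<longleftrightarrow>
     (\<forall>f\<in>A. \<forall>g\<in>A. supnorm Y (c0_diff Y (T f) (T g)) = supnorm X (c0_diff X f g))"

definition linear_on_C0 ::
  "'a topology \<Rightarrow> 'b topology \<Rightarrow> (('a \<Rightarrow> real) \<Rightarrow> ('b \<Rightarrow> real)) \<Rightarrow> bool" where
  "linear_on_C0 X Y T \<longleftrightarrow>
     (\<forall>f\<in>C0 X. \<forall>g\<in>C0 X. T (c0_add X f g) = c0_add Y (T f) (T g)) \<and>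
     (\<forall>a. \<forall>f\<in>C0 X. T (c0_scale X a f) = c0_scale Y a (T f))"

end

theory Submission
  imports Defs
begin

text \<open>
  The points of \<open>Y\<close> can be read off from the metric of the positive unit sphere.  Write
  \<open>M\<^sub>y\<close> for the set of the functions in the sphere that take the value \<open>1\<close> at \<open>y\<close>, and
  \<open>N f\<close> for the open ball of radius \<open>1\<close> about \<open>f\<close> in the sphere.  Distances in the sphere
  are at most \<open>1\<close>, and an inclusion between two of these balls, which an isometry of spheres
  transports, records peak points: if \<open>N f \<subseteq> N g\<close>, then \<open>g\<close> attains the value \<open>1\<close> only
  where \<open>f\<close> does (lemma \<open>near_subset_imp_peaks\<close>), and if \<open>f\<close> and \<open>g\<close> have a common peak, then
  \<open>(f + g) / 2\<close> belongs to the sphere and \<open>N ((f + g) / 2)\<close> contains \<open>N f\<close> and \<open>N g\<close> (lemma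
  \<open>near_subset_midpoint\<close>).

  Hence the balls of any finitely many members of \<open>M\<^sub>y\<close> lie in the ball of a single one.  Pulled
  back along \<open>\<Phi>\<close>, this says that any finitely many members of \<open>{f. \<Phi> f y = 1}\<close> have a common
  peak in \<open>X\<close>; sets of peaks are compact, so all members of \<open>{f. \<Phi> f y = 1}\<close> have a
  common peak \<open>x\<close> (lemma \<open>isometry_common_peak\<close>).  The distance of \<open>f\<close> from \<open>M\<^sub>x\<close> is
  \<open>1 - f x\<close>, so \<open>{f. \<Phi> f y = 1} \<subseteq> M\<^sub>x\<close> gives \<open>\<Phi> f y \<le> f x\<close> for every \<open>f\<close>.  The same argument for the
  inverse of \<open>\<Phi>\<close> yields \<open>y'\<close> with \<open>f x \<le> \<Phi> f y'\<close>; as the sphere separates points,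
  \<open>y' = y\<close>, and so \<open>\<Phi> f y = f x\<close> (lemma \<open>isometry_is_composition\<close>).

  Thus \<open>\<Phi>\<close> is composition with a bijection \<open>\<sigma>\<close> from \<open>Y\<close> to \<open>X\<close>, and composition with
  \<open>\<sigma>\<close> is the linear extension.  That it maps \<open>C\<^sub>0(X)\<close> to \<open>C\<^sub>0(Y)\<close>, and that there is no
  other extension, both follow because the sphere spans \<open>C\<^sub>0(X)\<close> (lemma
  \<open>pos_sphere_span_induct\<close>).
\<close>

section \<open>The space of continuous functions vanishing at infinity\<close>

lemma C0_continuous: "f \<in> C0 K \<Longrightarrow> continuous_map K euclideanreal f"
  by (simp add: C0_def)

lemma C0_extensional: "f \<in> C0 K \<Longrightarrow> f \<in> extensional (topspace K)"
  by (simp add: C0_def)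

lemma C0_small_off_compact:
  assumes "f \<in> C0 K" "0 < e"
  obtains C where "compactin K C" "\<And>x. x \<in> topspace K \<Longrightarrow> x \<notin> C \<Longrightarrow> \<bar>f x\<bar> < e"
proof -
  have "\<exists>C. compactin K C \<and> (\<forall>x \<in> topspace K - C. \<bar>f x\<bar> < e)"
    using assms unfolding C0_def by blast
  then show thesis
    using that by blast
qed

lemma C0_restrictI:
  assumes "continuous_map K euclideanreal f"
    and "\<And>e. 0 < e \<Longrightarrow> \<exists>C. compactin K C \<and> (\<forall>x \<in> topspace K - C. \<bar>f x\<bar> < e)"
  shows "(\<lambda>x\<in>topspace K. f x) \<in> C0 K"
proof -
  have "continuous_map K euclideanreal (\<lambda>x\<in>topspace K. f x)"
    by (rule continuous_map_eq[OF assms(1)]) simp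
  moreover have "\<exists>C. compactin K C \<and> (\<forall>x \<in> topspace K - C. \<bar>(\<lambda>x\<in>topspace K. f x) x\<bar> < e)"
    if "0 < e" for e
    using assms(2)[OF that] by auto
  ultimately show ?thesis
    by (auto simp: C0_def)
qed

lemma C0_comp:
  assumes f: "f \<in> C0 K" and \<phi>: "continuous_on UNIV \<phi>" and L: "\<And>t. \<bar>\<phi> t\<bar> \<le> L * \<bar>t::real\<bar>"
  shows "(\<lambda>x\<in>topspace K. \<phi> (f x)) \<in> C0 K"
proof (rule C0_restrictI)
  have "continuous_map K euclideanreal (\<phi> \<circ> f)"
    by (rule continuous_map_compose[OF C0_continuous[OF f]]) (simp add: \<phi>)
  then show "continuous_map K euclideanreal (\<lambda>x. \<phi> (f x))"
    by (simp add: o_def)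
next
  fix e :: real assume e: "0 < e"
  define M where "M = max L 1"
  have M: "0 < M" and bd: "\<bar>\<phi> t\<bar> \<le> M * \<bar>t\<bar>" for t
    using L[of t] mult_right_mono[of L M "\<bar>t\<bar>"] by (auto simp: M_def)
  obtain C where C: "compactin K C" "\<And>x. x \<in> topspace K \<Longrightarrow> x \<notin> C \<Longrightarrow> \<bar>f x\<bar> < e / M"
    using C0_small_off_compact[OF f, of "e / M"] e M by auto
  have "\<bar>\<phi> (f x)\<bar> < e" if "x \<in> topspace K - C" for x
    using C(2)[of x] that bd[of "f x"] M by (auto simp: field_simps)
  then show "\<exists>C. compactin K C \<and> (\<forall>x \<in> topspace K - C. \<bar>\<phi> (f x)\<bar> < e)"
    using C(1) by blast
qed

lemma C0_scale: "f \<in> C0 K \<Longrightarrow> c0_scale K a f \<in> C0 K"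
  unfolding c0_scale_def
  by (rule C0_comp[where L = "\<bar>a\<bar>"]) (auto intro: continuous_intros simp: abs_mult)

lemma C0_add:
  assumes f: "f \<in> C0 K" and g: "g \<in> C0 K"
  shows "c0_add K f g \<in> C0 K"
  unfolding c0_add_def
proof (rule C0_restrictI)
  show "continuous_map K euclideanreal (\<lambda>x. f x + g x)"
    using f g by (intro continuous_map_add C0_continuous)
next
  fix e :: real assume e: "0 < e"
  obtain C where C: "compactin K C" "\<And>x. x \<in> topspace K \<Longrightarrow> x \<notin> C \<Longrightarrow> \<bar>f x\<bar> < e/2"
    using C0_small_off_compact[OF f, of "e/2"] e by auto
  obtain D where D: "compactin K D" "\<And>x. x \<in> topspace K \<Longrightarrow> x \<notin> D \<Longrightarrow> \<bar>g x\<bar> < e/2"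
    using C0_small_off_compact[OF g, of "e/2"] e by auto
  have "\<bar>f x + g x\<bar> < e" if "x \<in> topspace K - (C \<union> D)" for x
    using C(2)[of x] D(2)[of x] that by auto
  then show "\<exists>C. compactin K C \<and> (\<forall>x \<in> topspace K - C. \<bar>f x + g x\<bar> < e)"
    using compactin_Un[OF C(1) D(1)] by blast
qed

lemma c0_diff_eq_add: "c0_diff K f g = c0_add K f (c0_scale K (-1) g)"
  by (auto simp: c0_diff_def c0_add_def c0_scale_def)

lemma C0_diff: "f \<in> C0 K \<Longrightarrow> g \<in> C0 K \<Longrightarrow> c0_diff K f g \<in> C0 K"
  by (simp add: c0_diff_eq_add C0_add C0_scale)

lemma C0_bdd_above:
  assumes "f \<in> C0 K"
  shows "bdd_above ((\<lambda>x. \<bar>f x\<bar>) ` topspace K)"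
proof -
  obtain C where C: "compactin K C" "\<And>x. x \<in> topspace K \<Longrightarrow> x \<notin> C \<Longrightarrow> \<bar>f x\<bar> < 1"
    using C0_small_off_compact[OF assms, of 1] by auto
  have "compact (f ` C)"
    using image_compactin[OF C(1) C0_continuous[OF assms]] by simp
  then have "bounded (f ` C)"
    by (rule compact_imp_bounded)
  then obtain B where B: "\<And>x. x \<in> C \<Longrightarrow> \<bar>f x\<bar> \<le> B"
    unfolding bounded_iff real_norm_def by blast
  have "\<bar>f x\<bar> \<le> max B 1" if "x \<in> topspace K" for x
    using B[of x] C(2)[OF that] by (cases "x \<in> C") auto
  then show ?thesis
    by (auto simp: bdd_above_def intro!: exI[of _ "max B 1"])
qed

lemma abs_le_supnorm:
  assumes "f \<in> C0 K" "x \<in> topspace K"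
  shows "\<bar>f x\<bar> \<le> supnorm K f"
  using cSUP_upper[OF assms(2) C0_bdd_above[OF assms(1)]] assms(2) by (auto simp: supnorm_def)

lemma supnorm_le:
  assumes "0 \<le> c" "\<And>x. x \<in> topspace K \<Longrightarrow> \<bar>f x\<bar> \<le> c"
  shows "supnorm K f \<le> c"
  using assms by (auto simp: supnorm_def intro: cSUP_least)

lemma supnorm_nonneg: "f \<in> C0 K \<Longrightarrow> 0 \<le> supnorm K f"
  using abs_le_supnorm[of f K] abs_ge_zero order_trans
  by (cases "topspace K = {}") (simp add: supnorm_def, blast)

lemma dist_le_supnorm:
  assumes "f \<in> C0 K" "g \<in> C0 K" "x \<in> topspace K"
  shows "\<bar>f x - g x\<bar> \<le> supnorm K (c0_diff K f g)"
  using abs_le_supnorm[OF C0_diff[OF assms(1,2)] assms(3)] assms(3) by (simp add: c0_diff_def)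

lemma supnorm_dist_le:
  assumes "0 \<le> c" "\<And>x. x \<in> topspace K \<Longrightarrow> \<bar>f x - g x\<bar> \<le> c"
  shows "supnorm K (c0_diff K f g) \<le> c"
  by (rule supnorm_le) (use assms in \<open>auto simp: c0_diff_def\<close>)

section \<open>The positive unit sphere\<close>

lemma pos_sphere_C0: "f \<in> pos_sphere K \<Longrightarrow> f \<in> C0 K"
  by (simp add: pos_sphere_def)

lemma pos_sphere_nonneg: "f \<in> pos_sphere K \<Longrightarrow> x \<in> topspace K \<Longrightarrow> 0 \<le> f x"
  by (simp add: pos_sphere_def)

lemma pos_sphere_le_one:
  assumes "f \<in> pos_sphere K" "x \<in> topspace K"
  shows "f x \<le> 1"
  using abs_le_supnorm[of f K x] assms by (auto simp: pos_sphere_def)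

lemma pos_sphereI:
  assumes "f \<in> C0 K" "\<And>x. x \<in> topspace K \<Longrightarrow> 0 \<le> f x \<and> f x \<le> 1" "x0 \<in> topspace K" "f x0 = 1"
  shows "f \<in> pos_sphere K"
proof -
  have "supnorm K f \<le> 1"
    by (rule supnorm_le) (use assms(2) in auto)
  with abs_le_supnorm[OF assms(1,3)] have "supnorm K f = 1"
    using assms(4) by simp
  with assms show ?thesis
    by (auto simp: pos_sphere_def)
qed

lemma pos_sphere_dist_le_one:
  assumes "f \<in> pos_sphere K" "g \<in> pos_sphere K"
  shows "supnorm K (c0_diff K f g) \<le> 1"
proof (rule supnorm_dist_le)
  fix x assume "x \<in> topspace K"
  then show "\<bar>f x - g x\<bar> \<le> 1"
    using assms[THEN pos_sphere_nonneg, of x] assms[THEN pos_sphere_le_one, of x] by auto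
qed simp

lemma pos_sphere_eqI:
  assumes "f \<in> pos_sphere K" "g \<in> pos_sphere K" "supnorm K (c0_diff K f g) = 0"
  shows "f = g"
proof (rule extensionalityI)
  show "f \<in> extensional (topspace K)" "g \<in> extensional (topspace K)"
    using assms by (auto intro: C0_extensional pos_sphere_C0)
  show "f x = g x" if "x \<in> topspace K" for x
    using dist_le_supnorm[of f K g x] assms that by (auto intro: pos_sphere_C0)
qed

text \<open>Off a compact set \<open>f < 1/2\<close>, and on that set \<open>f\<close> attains its maximum.\<close>

lemma pos_sphere_attains_one:
  assumes f: "f \<in> pos_sphere K"
  obtains x where "x \<in> topspace K" "f x = 1"
proof (rule ccontr)
  assume "\<not> thesis"
  with that have ne1: "f x \<noteq> 1" if "x \<in> topspace K" for x
    using \<open>x \<in> topspace K\<close> by blast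
  have lt: "f x < 1" if "x \<in> topspace K" for x
    using pos_sphere_le_one[OF f that] ne1[OF that] by simp
  obtain C where C: "compactin K C" "\<And>x. x \<in> topspace K \<Longrightarrow> x \<notin> C \<Longrightarrow> \<bar>f x\<bar> < 1/2"
    using C0_small_off_compact[OF pos_sphere_C0[OF f], of "1/2"] by auto
  have "\<exists>m<1. \<forall>x\<in>C. f x \<le> m"
  proof (cases "C = {}")
    case True
    then show ?thesis by (auto intro: exI[of _ 0])
  next
    case False
    have "compact (f ` C)"
      using image_compactin[OF C(1) C0_continuous[OF pos_sphere_C0[OF f]]] by simp
    then obtain x where "x \<in> C" "\<forall>z\<in>C. f z \<le> f x"
      using compact_attains_sup[of "f ` C"] False by auto
    then show ?thesis
      using lt compactin_subset_topspace[OF C(1)] by blast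
  qed
  then obtain m where m: "m < 1" "\<And>x. x \<in> C \<Longrightarrow> f x \<le> m"
    by blast
  have "supnorm K f \<le> max m (1/2)"
  proof (rule supnorm_le)
    show "\<bar>f x\<bar> \<le> max m (1/2)" if "x \<in> topspace K" for x
      using m(2)[of x] C(2)[OF that] pos_sphere_nonneg[OF f that] by (cases "x \<in> C") auto
  qed simp
  with f m(1) show False
    by (simp add: pos_sphere_def)
qed

lemma pos_sphere_midpoint:
  assumes f: "f \<in> pos_sphere K" and g: "g \<in> pos_sphere K"
    and "y \<in> topspace K" "f y = 1" "g y = 1"
  shows "c0_scale K (1/2) (c0_add K f g) \<in> pos_sphere K"
proof (rule pos_sphereI)
  show "c0_scale K (1/2) (c0_add K f g) \<in> C0 K"
    using f g by (intro C0_scale C0_add pos_sphere_C0)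
  show "0 \<le> c0_scale K (1/2) (c0_add K f g) x \<and> c0_scale K (1/2) (c0_add K f g) x \<le> 1"
    if x: "x \<in> topspace K" for x
    using f[THEN pos_sphere_nonneg, OF x] f[THEN pos_sphere_le_one, OF x]
      g[THEN pos_sphere_nonneg, OF x] g[THEN pos_sphere_le_one, OF x] x
    by (auto simp: c0_scale_def c0_add_def)
  show "c0_scale K (1/2) (c0_add K f g) y = 1"
    using assms by (auto simp: c0_scale_def c0_add_def)
qed (rule assms)

text \<open>
  A locally compact Hausdorff space is completely regular, and a Urysohn function that vanishes
  off a neighbourhood with compact closure vanishes at infinity.
\<close>

lemma pos_sphere_bump:
  assumes K: "locally_compact_space K" "Hausdorff_space K" and U: "openin K U" "x \<in> U"
  obtains f where "f \<in> pos_sphere K" "f x = 1" "\<And>z. z \<in> topspace K \<Longrightarrow> z \<notin> U \<Longrightarrow> f z = 0"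
proof -
  have x: "x \<in> topspace K"
    using U openin_subset by blast
  obtain V C where V: "openin K V" "compactin K C" "x \<in> V" "V \<subseteq> C"
    using K(1) x unfolding locally_compact_space_def by blast
  have "completely_regular_space K"
    using locally_compact_regular_imp_completely_regular_space K by blast
  moreover have "closedin K (topspace K - (U \<inter> V))" "x \<in> topspace K - (topspace K - (U \<inter> V))"
    using U V x by auto
  ultimately obtain h :: "'a \<Rightarrow> real" where h: "continuous_map K (top_of_set {0..1}) h" "h x = 0"
    "h ` (topspace K - (U \<inter> V)) \<subseteq> {1}"
    unfolding completely_regular_space_def by meson
  have hc: "continuous_map K euclideanreal h"
    and h01: "\<And>z. z \<in> topspace K \<Longrightarrow> 0 \<le> h z \<and> h z \<le> 1"
    using h(1) by (auto simp: continuous_map_in_subtopology)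
  define f where "f = (\<lambda>z\<in>topspace K. 1 - h z)"
  have f0: "f z = 0" if "z \<in> topspace K" "z \<notin> U \<inter> V" for z
    using h(3) that by (auto simp: f_def)
  have "f \<in> C0 K"
    unfolding f_def
  proof (rule C0_restrictI)
    show "continuous_map K euclideanreal (\<lambda>z. 1 - h z)"
      using hc by (intro continuous_map_diff) auto
    show "\<exists>C. compactin K C \<and> (\<forall>z \<in> topspace K - C. \<bar>1 - h z\<bar> < e)" if "0 < e" for e
    proof (intro exI conjI ballI)
      show "\<bar>1 - h z\<bar> < e" if z: "z \<in> topspace K - C" for z
      proof -
        have "z \<notin> U \<inter> V"
          using z V(4) by blast
        with f0[of z] z \<open>0 < e\<close> show ?thesis
          by (auto simp: f_def)
      qed
    qed (rule V)
  qed
  then have "f \<in> pos_sphere K"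
    by (rule pos_sphereI) (use h01 h(2) x in \<open>auto simp: f_def\<close>)
  then show thesis
    by (rule that) (use h(2) x f0 in \<open>auto simp: f_def\<close>)
qed

lemma pos_sphere_peak_at:
  assumes "locally_compact_space K" "Hausdorff_space K" "x \<in> topspace K"
  obtains f where "f \<in> pos_sphere K" "f x = 1"
  using pos_sphere_bump[OF assms(1,2) openin_topspace assms(3)] by metis

lemma pos_sphere_separates:
  assumes K: "locally_compact_space K" "Hausdorff_space K"
    and "x \<in> topspace K" "y \<in> topspace K" and le: "\<And>f. f \<in> pos_sphere K \<Longrightarrow> f x \<le> f y"
  shows "x = y"
proof (rule ccontr)
  assume "x \<noteq> y"
  then obtain U where U: "openin K U" "x \<in> U" "y \<notin> U"
    using K(2) assms(3,4) unfolding Hausdorff_space_def disjnt_iff by metis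
  obtain f where "f \<in> pos_sphere K" "f x = 1" "f y = 0"
    using pos_sphere_bump[OF K U(1,2)] assms(4) U(3) by metis
  with le show False
    by fastforce
qed

text \<open>
  If \<open>f x > 0\<close>, then \<open>min 1 (f / f x)\<close> is a function that peaks at \<open>x\<close> and is as close to \<open>f\<close> as
  possible; if \<open>f x = 0\<close>, then any peak function at \<open>x\<close> will do, as distances in the sphere are at
  most \<open>1\<close>.  This bounds the distance of \<open>f\<close> from the functions that peak at \<open>x\<close> by \<open>1 - f x\<close>; the
  reverse bound is evident.
\<close>

lemma nearest_peak_at:
  assumes K: "locally_compact_space K" "Hausdorff_space K"
    and f: "f \<in> pos_sphere K" and x: "x \<in> topspace K"
  obtains g where "g \<in> pos_sphere K" "g x = 1" "supnorm K (c0_diff K f g) \<le> 1 - f x"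
proof (cases "f x = 0")
  case True
  obtain g where "g \<in> pos_sphere K" "g x = 1"
    using pos_sphere_peak_at[OF K x] .
  then show thesis
    using that pos_sphere_dist_le_one[OF f] True by simp
next
  case False
  define c where "c = f x"
  have c: "0 < c" "c \<le> 1"
    using False pos_sphere_nonneg[OF f x] pos_sphere_le_one[OF f x] by (auto simp: c_def)
  define g where "g = (\<lambda>z\<in>topspace K. min 1 (f z / c))"
  have "g \<in> C0 K"
    unfolding g_def
  proof (rule C0_comp[OF pos_sphere_C0[OF f], where L = "1 / c"])
    show "continuous_on UNIV (\<lambda>t. min 1 (t / c))"
      using c by (intro continuous_intros) auto
    show "\<bar>min 1 (t / c)\<bar> \<le> 1 / c * \<bar>t\<bar>" for t
      using c by (auto simp: min_def abs_if field_simps)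
  qed
  then have g: "g \<in> pos_sphere K"
    by (rule pos_sphereI[OF _ _ x]) (use c x pos_sphere_nonneg[OF f] in \<open>auto simp: g_def c_def\<close>)
  have "supnorm K (c0_diff K f g) \<le> 1 - c"
  proof (rule supnorm_dist_le)
    fix z assume z: "z \<in> topspace K"
    show "\<bar>f z - g z\<bar> \<le> 1 - c"
    proof (cases "f z \<le> c")
      case True
      (* Since g z = f z / c here, the difference g z - f z is (1 - c) times a factor in [0, 1]. *)
      define d where "d = (1 - c) * (f z / c)"
      have "d \<le> 1 - c"
        unfolding d_def using True c by (intro mult_left_le) auto
      moreover have "g z - f z = d"
        using True c z by (auto simp: d_def g_def min_def field_simps)
      moreover have "0 \<le> d"
        using c pos_sphere_nonneg[OF f z] by (auto simp: d_def)
      ultimately show ?thesis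
        by (simp add: abs_le_iff)
    next
      case False
      then have "g z = 1"
        using c z by (auto simp: g_def)
      then show ?thesis
        using False pos_sphere_le_one[OF f z] by auto
    qed
  qed (use c in auto)
  with g show thesis
    using that c x by (auto simp: g_def c_def)
qed

text \<open>
  Positive and negative parts show that the sphere spans \<open>C\<^sub>0(K)\<close>.  The zero function is a case
  of its own because the sphere is empty if \<open>K\<close> is.
\<close>

lemma pos_sphere_span_induct [consumes 1, case_names zero sphere add scale]:
  assumes f: "f \<in> C0 K"
    and zero: "P (\<lambda>x\<in>topspace K. 0)"
    and sphere: "\<And>u. u \<in> pos_sphere K \<Longrightarrow> P u"
    and add: "\<And>f g. f \<in> C0 K \<Longrightarrow> g \<in> C0 K \<Longrightarrow> P f \<Longrightarrow> P g \<Longrightarrow> P (c0_add K f g)"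
    and scale: "\<And>a f. f \<in> C0 K \<Longrightarrow> P f \<Longrightarrow> P (c0_scale K a f)"
  shows "P f"
proof -
  have nonneg: "P p" if p: "p \<in> C0 K" "\<And>x. x \<in> topspace K \<Longrightarrow> 0 \<le> p x" for p
  proof (cases "\<exists>x\<in>topspace K. p x \<noteq> 0")
    case False
    then have "p = (\<lambda>x\<in>topspace K. 0)"
      using C0_extensional[OF p(1)] by (intro extensionalityI[where A = "topspace K"]) auto
    then show ?thesis
      using zero by simp
  next
    case True
    define s where "s = supnorm K p"
    have s: "0 < s"
      using True abs_le_supnorm[OF p(1)] unfolding s_def
      by (metis abs_le_zero_iff linorder_not_less order_trans)
    have "c0_scale K (1/s) p \<in> pos_sphere K"
    proof -
      have "supnorm K (c0_scale K (1/s) p) \<le> 1"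
        using s abs_le_supnorm[OF p(1)]
        by (intro supnorm_le) (auto simp: c0_scale_def s_def)
      moreover have "s \<le> s * supnorm K (c0_scale K (1/s) p)"
        unfolding s_def
      proof (rule supnorm_le)
        show "0 \<le> supnorm K p * supnorm K (c0_scale K (1/supnorm K p) p)"
          by (intro mult_nonneg_nonneg supnorm_nonneg C0_scale p(1))
        show "\<bar>p x\<bar> \<le> supnorm K p * supnorm K (c0_scale K (1/supnorm K p) p)"
          if "x \<in> topspace K" for x
          using abs_le_supnorm[OF C0_scale[OF p(1)] that, of "1/s"] s that
          by (auto simp: c0_scale_def s_def field_simps)
      qed
      ultimately have "supnorm K (c0_scale K (1/s) p) = 1"
        using s by simp
      then show ?thesis
        using C0_scale[OF p(1), of "1/s"] p(2) s by (simp add: pos_sphere_def c0_scale_def)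
    qed
    then have "P (c0_scale K s (c0_scale K (1/s) p))"
      by (intro scale sphere C0_scale p(1))
    moreover have "c0_scale K s (c0_scale K (1/s) p) = p"
      using C0_extensional[OF p(1)] s
      by (intro extensionalityI[where A = "topspace K"]) (auto simp: c0_scale_def)
    ultimately show ?thesis
      by simp
  qed
  define p where "p = (\<lambda>x\<in>topspace K. max 0 (f x))"
  define n where "n = (\<lambda>x\<in>topspace K. max 0 (- f x))"
  have p: "p \<in> C0 K" unfolding p_def
    by (rule C0_comp[OF f, where L = 1]) (auto intro!: continuous_intros)
  have n: "n \<in> C0 K" unfolding n_def
    by (rule C0_comp[OF f, where L = 1]) (auto intro!: continuous_intros)
  have "P (c0_add K p (c0_scale K (-1) n))"
    by (intro add scale nonneg C0_scale p n) (auto simp: p_def n_def)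
  moreover have "c0_add K p (c0_scale K (-1) n) = f"
    using C0_extensional[OF f]
    by (intro extensionalityI[where A = "topspace K"])
      (auto simp: c0_add_def c0_scale_def p_def n_def)
  ultimately show ?thesis
    by simp
qed

section \<open>Reading peaks off the metric\<close>

definition near :: "'a topology \<Rightarrow> ('a \<Rightarrow> real) \<Rightarrow> ('a \<Rightarrow> real) set" where
  "near K f = {k \<in> pos_sphere K. supnorm K (c0_diff K f k) < 1}"

text \<open>
  If \<open>f z < 1\<close>, then the function \<open>(f - f z)\<^sup>+\<close>, rescaled to norm \<open>1\<close>, stays at distance at most
  \<open>f z\<close> from \<open>f\<close> but vanishes at \<open>z\<close>, so it has distance \<open>1\<close> from any \<open>g\<close> with \<open>g z = 1\<close>.
\<close>

lemma near_subset_imp_peaks: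
  assumes f: "f \<in> pos_sphere K" and g: "g \<in> pos_sphere K" and sub: "near K f \<subseteq> near K g"
    and z: "z \<in> topspace K" "g z = 1"
  shows "f z = 1"
proof (rule ccontr)
  assume "f z \<noteq> 1"
  define c where "c = f z"
  have c: "0 \<le> c" "c < 1"
    using pos_sphere_nonneg[OF f z(1)] pos_sphere_le_one[OF f z(1)] \<open>f z \<noteq> 1\<close> by (auto simp: c_def)
  define h where "h = (\<lambda>x\<in>topspace K. max 0 (f x - c) / (1 - c))"
  have hC: "h \<in> C0 K"
    unfolding h_def
  proof (rule C0_comp[OF pos_sphere_C0[OF f], where L = "1 / (1 - c)"])
    show "continuous_on UNIV (\<lambda>t. max 0 (t - c) / (1 - c))"
      using c by (intro continuous_intros) auto
    show "\<bar>max 0 (t - c) / (1 - c)\<bar> \<le> 1 / (1 - c) * \<bar>t\<bar>" for t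
      using c by (auto simp: divide_simps)
  qed
  obtain x where x: "x \<in> topspace K" "f x = 1"
    using pos_sphere_attains_one[OF f] .
  have h: "h \<in> pos_sphere K"
  proof (rule pos_sphereI[OF hC _ x(1)])
    show "0 \<le> h w \<and> h w \<le> 1" if "w \<in> topspace K" for w
      using that c pos_sphere_le_one[OF f that] by (auto simp: h_def divide_simps)
    show "h x = 1"
      using x c by (auto simp: h_def)
  qed
  have "supnorm K (c0_diff K f h) \<le> c"
  proof (rule supnorm_dist_le)
    fix w assume w: "w \<in> topspace K"
    show "\<bar>f w - h w\<bar> \<le> c"
    proof (cases "f w \<le> c")
      case True
      then show ?thesis
        using w pos_sphere_nonneg[OF f w] by (auto simp: h_def)
    next
      case False
      (* The difference f w - h w is c times a factor that lies in [0, 1], as c < f w. *)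
      define d where "d = c * ((1 - f w) / (1 - c))"
      have "f w - h w = d"
        using False c w by (auto simp: d_def h_def field_simps)
      moreover have "d \<le> c * 1"
        unfolding d_def using False c by (intro mult_left_mono) auto
      moreover have "0 \<le> d"
        using c pos_sphere_le_one[OF f w] by (auto simp: d_def)
      ultimately show ?thesis
        by linarith
    qed
  qed (use c in auto)
  then have "h \<in> near K f"
    using h c by (auto simp: near_def)
  with sub have "supnorm K (c0_diff K g h) < 1"
    by (auto simp: near_def)
  moreover have "\<bar>g z - h z\<bar> = 1"
    using z by (auto simp: h_def c_def)
  ultimately show False
    using dist_le_supnorm[OF pos_sphere_C0[OF g] hC z(1)] by simp
qed

text \<open>
  The distance of \<open>k\<close> from the midpoint is at most the mean of its distances from \<open>f\<close> and from
  \<open>g\<close>, and neither of these exceeds \<open>1\<close>.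
\<close>

lemma near_subset_midpoint:
  assumes f: "f \<in> pos_sphere K" and g: "g \<in> pos_sphere K"
  shows "near K f \<union> near K g \<subseteq> near K (c0_scale K (1/2) (c0_add K f g))"
proof -
  have *: "k \<in> near K (c0_scale K (1/2) (c0_add K f g))"
    if k: "k \<in> pos_sphere K"
      and d: "supnorm K (c0_diff K f k) + supnorm K (c0_diff K g k) < 2" for k
  proof -
    let ?r = "(supnorm K (c0_diff K f k) + supnorm K (c0_diff K g k)) / 2"
    have "supnorm K (c0_diff K (c0_scale K (1/2) (c0_add K f g)) k) \<le> ?r"
    proof (rule supnorm_dist_le)
      show "0 \<le> ?r"
        using f g k by (intro divide_nonneg_pos add_nonneg_nonneg supnorm_nonneg C0_diff)
          (simp_all add: pos_sphere_C0)
      fix x assume x: "x \<in> topspace K"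
      show "\<bar>c0_scale K (1/2) (c0_add K f g) x - k x\<bar> \<le> ?r"
        using dist_le_supnorm[OF f[THEN pos_sphere_C0] k[THEN pos_sphere_C0] x]
          dist_le_supnorm[OF g[THEN pos_sphere_C0] k[THEN pos_sphere_C0] x] x
        by (simp add: c0_scale_def c0_add_def abs_le_iff field_simps)
    qed
    then show ?thesis
      using k d by (auto simp: near_def)
  qed
  show ?thesis
  proof
    fix k assume k: "k \<in> near K f \<union> near K g"
    then have "k \<in> pos_sphere K"
      by (auto simp: near_def)
    moreover from this have "supnorm K (c0_diff K f k) + supnorm K (c0_diff K g k) < 2"
      using k pos_sphere_dist_le_one[OF f, of k] pos_sphere_dist_le_one[OF g, of k]
      by (auto simp: near_def)
    ultimately show "k \<in> near K (c0_scale K (1/2) (c0_add K f g))"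
      by (rule *)
  qed
qed

text \<open>
  This is the form in which a common peak is transported by an isometry: the conclusion without
  \<open>h y = 1\<close>, which is kept for the induction, only speaks about distances in the sphere.
\<close>

lemma finite_peaks_have_near_bound:
  assumes "finite G" "G \<noteq> {}" "y \<in> topspace K" "\<And>g. g \<in> G \<Longrightarrow> g \<in> pos_sphere K \<and> g y = 1"
  shows "\<exists>h\<in>pos_sphere K. h y = 1 \<and> (\<forall>g\<in>G. near K g \<subseteq> near K h)"
  using assms(1,2,4)
proof (induction rule: finite_ne_induct)
  case (singleton g)
  then show ?case by auto
next
  case (insert g G)
  then obtain h where h: "h \<in> pos_sphere K" "h y = 1" "\<And>g. g \<in> G \<Longrightarrow> near K g \<subseteq> near K h"
    by auto
  have g: "g \<in> pos_sphere K" "g y = 1"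
    using insert by auto
  let ?m = "c0_scale K (1/2) (c0_add K g h)"
  have "?m \<in> pos_sphere K"
    using pos_sphere_midpoint[OF g(1) h(1) assms(3) g(2) h(2)] .
  moreover have "?m y = 1"
    using g h assms(3) by (simp add: c0_scale_def c0_add_def)
  ultimately show ?case
    using near_subset_midpoint[OF g(1) h(1)] h(3) by (intro bexI[of _ ?m]) blast+
qed

text \<open>
  The set where a function of the sphere takes the value \<open>1\<close> is closed and, since the function
  vanishes at infinity, contained in a compact set.
\<close>

lemma common_peak_if_finite_common_peaks:
  assumes F: "F \<subseteq> pos_sphere K" "F \<noteq> {}"
    and fin: "\<And>G. finite G \<Longrightarrow> G \<noteq> {} \<Longrightarrow> G \<subseteq> F \<Longrightarrow> \<exists>x\<in>topspace K. \<forall>f\<in>G. f x = 1"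
  obtains x where "x \<in> topspace K" "\<And>f. f \<in> F \<Longrightarrow> f x = 1"
proof -
  define P where "P f = {x \<in> topspace K. f x \<in> {1::real}}" for f
  have closed: "closedin K (P f)" if "f \<in> F" for f
    unfolding P_def
    by (rule closedin_continuous_map_preimage[OF C0_continuous])
      (use F that in \<open>auto intro: pos_sphere_C0\<close>)
  obtain f0 where f0: "f0 \<in> F"
    using F by blast
  obtain C where C: "compactin K C" "\<And>x. x \<in> topspace K \<Longrightarrow> x \<notin> C \<Longrightarrow> \<bar>f0 x\<bar> < 1"
    using C0_small_off_compact[OF pos_sphere_C0, of f0 K 1] f0 F by auto
  have "P f0 \<subseteq> C"
    using C(2) by (force simp: P_def)
  then have "compactin K (P f0)"
    using closed_compactin[OF C(1)] closed[OF f0] by blast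
  moreover have "P f0 \<inter> \<Inter>\<F> \<noteq> {}" if \<F>: "finite \<F>" "\<F> \<subseteq> P ` F" for \<F>
  proof -
    obtain G where G: "G \<subseteq> F" "finite G" "\<F> = P ` G"
      using finite_subset_image[OF \<F>] by blast
    obtain x where "x \<in> topspace K" "\<forall>f\<in>insert f0 G. f x = 1"
      using fin[of "insert f0 G"] G f0 by auto
    then have "x \<in> P f0 \<inter> \<Inter>\<F>"
      using G by (auto simp: P_def)
    then show ?thesis by blast
  qed
  ultimately have "P f0 \<inter> \<Inter>(P ` F) \<noteq> {}"
    using closed unfolding compactin_fip by blast
  then show thesis
    using that by (auto simp: P_def)
qed

section \<open>Surjective isometries between positive unit spheres\<close>

lemma isometry_near_iff:
  assumes iso: "isometry_on X Y (pos_sphere X) \<Phi>" and im: "\<Phi> ` pos_sphere X = pos_sphere Y"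
    and "f \<in> pos_sphere X" "k \<in> pos_sphere X"
  shows "\<Phi> k \<in> near Y (\<Phi> f) \<longleftrightarrow> k \<in> near X f"
proof -
  have "\<Phi> k \<in> pos_sphere Y"
    using im assms(4) by blast
  then show ?thesis
    using iso assms(3,4) by (simp add: near_def isometry_on_def)
qed

text \<open>
  The functions \<open>\<Phi> f\<close> that peak at \<open>y\<close> have balls with common upper bounds, finitely many at a
  time.  Such a bound is \<open>\<Phi> h\<close> for some \<open>h\<close>, and then every peak of \<open>h\<close> is a common peak of the
  corresponding \<open>f\<close>; compactness passes from finite subfamilies to the whole family.
\<close>

lemma isometry_common_peak:
  assumes Y: "locally_compact_space Y" "Hausdorff_space Y"
    and im: "\<Phi> ` pos_sphere X = pos_sphere Y" and iso: "isometry_on X Y (pos_sphere X) \<Phi>"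
    and y: "y \<in> topspace Y"
  obtains x where "x \<in> topspace X" "\<And>f. f \<in> pos_sphere X \<Longrightarrow> \<Phi> f y = 1 \<Longrightarrow> f x = 1"
proof -
  let ?F = "{f \<in> pos_sphere X. \<Phi> f y = 1}"
  obtain g where g: "g \<in> pos_sphere Y" "g y = 1"
    using pos_sphere_peak_at[OF Y y] .
  then obtain k where "k \<in> pos_sphere X" "g = \<Phi> k"
    using im by blast
  with g have ne: "?F \<noteq> {}"
    by blast
  have fin: "\<exists>x\<in>topspace X. \<forall>f\<in>G. f x = 1" if G: "finite G" "G \<noteq> {}" "G \<subseteq> ?F" for G
  proof -
    have "\<exists>h\<in>pos_sphere Y. h y = 1 \<and> (\<forall>g\<in>\<Phi> ` G. near Y g \<subseteq> near Y h)"
      by (rule finite_peaks_have_near_bound[OF _ _ y]) (use G im in auto)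
    then obtain h where h: "h \<in> pos_sphere X" "\<And>f. f \<in> G \<Longrightarrow> near Y (\<Phi> f) \<subseteq> near Y (\<Phi> h)"
      unfolding im[symmetric] by blast
    obtain x where x: "x \<in> topspace X" "h x = 1"
      using pos_sphere_attains_one[OF h(1)] .
    have "f x = 1" if f: "f \<in> G" for f
    proof (rule near_subset_imp_peaks[OF _ h(1) _ x])
      show f': "f \<in> pos_sphere X"
        using f G by auto
      show "near X f \<subseteq> near X h"
      proof
        fix k assume k: "k \<in> near X f"
        then have "k \<in> pos_sphere X"
          by (simp add: near_def)
        with k h f f' show "k \<in> near X h"
          using isometry_near_iff[OF iso im] by blast
      qed
    qed
    with x show ?thesis by blast
  qed
  obtain x where x: "x \<in> topspace X" "\<And>f. f \<in> ?F \<Longrightarrow> f x = 1"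
    by (rule common_peak_if_finite_common_peaks[OF _ ne fin]) auto
  show thesis
    by (rule that[OF x(1)]) (simp add: x(2))
qed

text \<open>
  If every \<open>k\<close> for which \<open>\<Phi> k\<close> peaks at \<open>y\<close> peaks at \<open>x\<close>, then the distance of \<open>f\<close> from the
  functions that peak at \<open>x\<close> is at most the distance of \<open>\<Phi> f\<close> from those that peak at \<open>y\<close>,
  that is, \<open>1 - f x \<le> 1 - \<Phi> f y\<close>.
\<close>

lemma isometry_dominated_at_point:
  assumes Y: "locally_compact_space Y" "Hausdorff_space Y"
    and im: "\<Phi> ` pos_sphere X = pos_sphere Y" and iso: "isometry_on X Y (pos_sphere X) \<Phi>"
    and y: "y \<in> topspace Y"
  obtains x where "x \<in> topspace X" "\<And>f. f \<in> pos_sphere X \<Longrightarrow> \<Phi> f y \<le> f x"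
proof -
  obtain x where x: "x \<in> topspace X" "\<And>f. f \<in> pos_sphere X \<Longrightarrow> \<Phi> f y = 1 \<Longrightarrow> f x = 1"
    using isometry_common_peak[OF Y im iso y] by blast
  have "\<Phi> f y \<le> f x" if f: "f \<in> pos_sphere X" for f
  proof -
    have "\<Phi> f \<in> pos_sphere Y"
      using f im by blast
    then obtain g where g: "g \<in> pos_sphere Y" "g y = 1" "supnorm Y (c0_diff Y (\<Phi> f) g) \<le> 1 - \<Phi> f y"
      using nearest_peak_at[OF Y _ y] by blast
    then obtain k where k: "k \<in> pos_sphere X" "g = \<Phi> k"
      using im by blast
    have "k x = 1"
      using x(2) k g(2) by blast
    have "\<bar>f x - k x\<bar> \<le> supnorm X (c0_diff X f k)"
      using f k x by (intro dist_le_supnorm pos_sphere_C0)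
    also have "\<dots> \<le> 1 - \<Phi> f y"
      using g(3) iso f k by (simp add: isometry_on_def)
    finally show ?thesis
      using \<open>k x = 1\<close> by simp
  qed
  with x(1) show thesis
    using that by blast
qed

lemma isometry_inv_into:
  assumes im: "\<Phi> ` pos_sphere X = pos_sphere Y" and iso: "isometry_on X Y (pos_sphere X) \<Phi>"
  defines "\<Psi> \<equiv> inv_into (pos_sphere X) \<Phi>"
  shows "\<Psi> ` pos_sphere Y = pos_sphere X" "isometry_on Y X (pos_sphere Y) \<Psi>"
    "\<And>f. f \<in> pos_sphere X \<Longrightarrow> \<Psi> (\<Phi> f) = f"
proof -
  have "inj_on \<Phi> (pos_sphere X)"
  proof (rule inj_onI)
    fix f g assume fg: "f \<in> pos_sphere X" "g \<in> pos_sphere X" "\<Phi> f = \<Phi> g"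
    have "supnorm X (c0_diff X f g) = supnorm Y (c0_diff Y (\<Phi> f) (\<Phi> g))"
      using iso fg(1,2) unfolding isometry_on_def by simp
    also have "\<dots> \<le> 0"
      by (rule supnorm_dist_le) (simp_all add: fg(3))
    finally have "supnorm X (c0_diff X f g) \<le> 0" .
    moreover have "0 \<le> supnorm X (c0_diff X f g)"
      using fg(1,2) by (intro supnorm_nonneg C0_diff pos_sphere_C0)
    ultimately show "f = g"
      by (intro pos_sphere_eqI[OF fg(1,2)]) simp
  qed
  then show inv: "\<Psi> (\<Phi> f) = f" if "f \<in> pos_sphere X" for f
    using that by (simp add: \<Psi>_def)
  then show "\<Psi> ` pos_sphere Y = pos_sphere X"
    unfolding im[symmetric] image_image by simp
  show "isometry_on Y X (pos_sphere Y) \<Psi>"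
    using iso unfolding im[symmetric] isometry_on_def by (simp add: inv)
qed

text \<open>
  The domination at a point for \<open>\<Phi>\<close> and for its inverse gives \<open>\<Phi> f y \<le> f x \<le> \<Phi> f y'\<close> for all
  \<open>f\<close>; separation of points forces \<open>y = y'\<close>.
\<close>

lemma isometry_is_composition:
  assumes X: "locally_compact_space X" "Hausdorff_space X"
    and Y: "locally_compact_space Y" "Hausdorff_space Y"
    and im: "\<Phi> ` pos_sphere X = pos_sphere Y" and iso: "isometry_on X Y (pos_sphere X) \<Phi>"
  obtains \<sigma> where "\<sigma> \<in> topspace Y \<rightarrow> topspace X"
    "\<And>f y. f \<in> pos_sphere X \<Longrightarrow> y \<in> topspace Y \<Longrightarrow> \<Phi> f y = f (\<sigma> y)"
proof -
  have "\<exists>x\<in>topspace X. \<forall>f\<in>pos_sphere X. \<Phi> f y = f x" if y: "y \<in> topspace Y" for y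
  proof -
    obtain x where x: "x \<in> topspace X" "\<And>f. f \<in> pos_sphere X \<Longrightarrow> \<Phi> f y \<le> f x"
      using isometry_dominated_at_point[OF Y im iso y] by blast
    obtain y' where y': "y' \<in> topspace Y"
      "\<And>g. g \<in> pos_sphere Y \<Longrightarrow> inv_into (pos_sphere X) \<Phi> g x \<le> g y'"
      using isometry_dominated_at_point[OF X isometry_inv_into(1,2)[OF im iso] x(1)] by blast
    have ge: "f x \<le> \<Phi> f y'" if "f \<in> pos_sphere X" for f
    proof -
      have "\<Phi> f \<in> pos_sphere Y"
        using im that by blast
      then show ?thesis
        using y'(2)[of "\<Phi> f"] by (simp add: isometry_inv_into(3)[OF im iso that])
    qed
    have "y = y'"
    proof (rule pos_sphere_separates[OF Y y y'(1)])
      show "g y \<le> g y'" if g: "g \<in> pos_sphere Y" for g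
      proof -
        obtain f where f: "f \<in> pos_sphere X" "g = \<Phi> f"
          using g im by blast
        with order_trans[OF x(2)[OF f(1)] ge[OF f(1)]] show ?thesis
          by simp
      qed
    qed
    show ?thesis
    proof (intro bexI[of _ x] ballI antisym)
      show "f x \<le> \<Phi> f y" if "f \<in> pos_sphere X" for f
        using ge[OF that] \<open>y = y'\<close> by simp
    qed (use x in auto)
  qed
  then have "\<exists>\<sigma>. \<forall>y\<in>topspace Y. \<sigma> y \<in> topspace X \<and> (\<forall>f\<in>pos_sphere X. \<Phi> f y = f (\<sigma> y))"
    unfolding Bex_def by (intro bchoice) blast
  then obtain \<sigma> where "\<forall>y\<in>topspace Y. \<sigma> y \<in> topspace X \<and> (\<forall>f\<in>pos_sphere X. \<Phi> f y = f (\<sigma> y))"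
    by blast
  then show thesis
    using that[of \<sigma>] by blast
qed

section \<open>The linear extension\<close>

text \<open>
  Composition with \<open>\<sigma>\<close> preserves linear combinations, and it maps the sphere, which spans
  \<open>C\<^sub>0(X)\<close>, into \<open>C\<^sub>0(Y)\<close> because there it is \<open>\<Phi>\<close>.
\<close>

lemma C0_composition:
  assumes im: "\<Phi> ` pos_sphere X = pos_sphere Y" and \<sigma>: "\<sigma> \<in> topspace Y \<rightarrow> topspace X"
    and comp: "\<And>f y. f \<in> pos_sphere X \<Longrightarrow> y \<in> topspace Y \<Longrightarrow> \<Phi> f y = f (\<sigma> y)"
    and f: "f \<in> C0 X"
  shows "(\<lambda>y\<in>topspace Y. f (\<sigma> y)) \<in> C0 Y"
proof -
  have \<sigma>X: "\<sigma> y \<in> topspace X" if "y \<in> topspace Y" for y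
    using \<sigma> that by blast
  from f show ?thesis
  proof (induction rule: pos_sphere_span_induct)
    case zero
    have "(\<lambda>y\<in>topspace Y. 0) \<in> C0 Y"
      by (rule C0_restrictI) (auto intro: exI[of _ "{}"])
    moreover have "(\<lambda>y\<in>topspace Y. (\<lambda>x\<in>topspace X. 0) (\<sigma> y)) = (\<lambda>y\<in>topspace Y. 0 :: real)"
      by (rule restrict_ext) (simp add: \<sigma>X)
    ultimately show ?case by (simp only:)
  next
    case (sphere u)
    then have \<Phi>u: "\<Phi> u \<in> C0 Y"
      using im pos_sphere_C0 by blast
    have "\<Phi> u = (\<lambda>y\<in>topspace Y. u (\<sigma> y))"
      using C0_extensional[OF \<Phi>u] comp[OF sphere]
      by (intro extensionalityI[where A = "topspace Y"]) auto
    with \<Phi>u show ?case by (simp only:)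
  next
    case (add f g)
    have "(\<lambda>y\<in>topspace Y. c0_add X f g (\<sigma> y))
      = c0_add Y (\<lambda>y\<in>topspace Y. f (\<sigma> y)) (\<lambda>y\<in>topspace Y. g (\<sigma> y))"
      unfolding c0_add_def by (rule restrict_ext) (simp add: \<sigma>X)
    with add show ?case
      by (simp only: C0_add)
  next
    case (scale a f)
    have "(\<lambda>y\<in>topspace Y. c0_scale X a f (\<sigma> y)) = c0_scale Y a (\<lambda>y\<in>topspace Y. f (\<sigma> y))"
      unfolding c0_scale_def by (rule restrict_ext) (simp add: \<sigma>X)
    with scale show ?case
      by (simp only: C0_scale)
  qed
qed

lemma supnorm_composition:
  assumes "\<sigma> ` topspace Y = topspace X"
  shows "supnorm Y (\<lambda>y\<in>topspace Y. f (\<sigma> y)) = supnorm X f"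
proof -
  have "(\<lambda>y. \<bar>(\<lambda>y\<in>topspace Y. f (\<sigma> y)) y\<bar>) ` topspace Y = (\<lambda>x. \<bar>f x\<bar>) ` topspace X"
    unfolding assms[symmetric] image_image by (rule image_cong) auto
  moreover have "topspace Y = {} \<longleftrightarrow> topspace X = {}"
    using assms by blast
  ultimately show ?thesis
    unfolding supnorm_def by simp
qed

lemma linear_on_C0_eqI:
  assumes T: "linear_on_C0 X Y T" and T': "linear_on_C0 X Y T'"
    and eq: "\<And>u. u \<in> pos_sphere X \<Longrightarrow> T u = T' u" and f: "f \<in> C0 X"
  shows "T f = T' f"
  using f
proof (induction rule: pos_sphere_span_induct)
  case zero
  have z: "(\<lambda>x\<in>topspace X. 0) = c0_scale X 0 f"
    by (auto simp: c0_scale_def)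
  have "c0_scale Y 0 (T f) = c0_scale Y 0 (T' f)"
    by (simp add: c0_scale_def)
  then show ?case
    unfolding z using T T' f by (simp add: linear_on_C0_def)
next
  case (add f g)
  then show ?case
    using T T' by (simp add: linear_on_C0_def)
next
  case (scale a f)
  then show ?case
    using T T' by (simp add: linear_on_C0_def)
qed (rule eq)

theorem corollary3p2:
  fixes X :: "'a topology" and Y :: "'b topology"
    and \<Phi> :: "('a \<Rightarrow> real) \<Rightarrow> ('b \<Rightarrow> real)"
  assumes "locally_compact_space X" and "Hausdorff_space X"
    and "locally_compact_space Y" and "Hausdorff_space Y"
    and "\<Phi> ` pos_sphere X = pos_sphere Y"
    and "isometry_on X Y (pos_sphere X) \<Phi>"
  shows "\<exists>!T. T \<in> C0 X \<rightarrow>\<^sub>E C0 Y \<and> T ` C0 X = C0 Y \<and>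
              linear_on_C0 X Y T \<and> isometry_on X Y (C0 X) T \<and>
              (\<forall>f\<in>pos_sphere X. T f = \<Phi> f)"
proof -
  note X = assms(1,2) and Y = assms(3,4) and im = assms(5) and iso = assms(6)
  let ?\<Psi> = "inv_into (pos_sphere X) \<Phi>"
  note im' = isometry_inv_into(1)[OF im iso]
  obtain \<sigma> where \<sigma>: "\<sigma> \<in> topspace Y \<rightarrow> topspace X"
    "\<And>f y. f \<in> pos_sphere X \<Longrightarrow> y \<in> topspace Y \<Longrightarrow> \<Phi> f y = f (\<sigma> y)"
    using isometry_is_composition[OF X Y im iso] by blast
  obtain \<tau> where \<tau>: "\<tau> \<in> topspace X \<rightarrow> topspace Y"
    "\<And>g x. g \<in> pos_sphere Y \<Longrightarrow> x \<in> topspace X \<Longrightarrow> ?\<Psi> g x = g (\<tau> x)"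
    using isometry_is_composition[OF Y X isometry_inv_into(1,2)[OF im iso]] by blast
  have \<sigma>\<tau>: "\<sigma> (\<tau> x) = x" if x: "x \<in> topspace X" for x
  proof (rule pos_sphere_separates[OF X _ x])
    show "\<sigma> (\<tau> x) \<in> topspace X"
      using \<sigma>(1) \<tau>(1) x by blast
    show "f (\<sigma> (\<tau> x)) \<le> f x" if f: "f \<in> pos_sphere X" for f
    proof -
      have "\<tau> x \<in> topspace Y" "\<Phi> f \<in> pos_sphere Y"
        using \<tau>(1) x f im by blast+
      then show ?thesis
        using \<sigma>(2)[OF f, of "\<tau> x"] \<tau>(2)[of "\<Phi> f", OF _ x]
        by (simp add: isometry_inv_into(3)[OF im iso f])
    qed
  qed
  have \<tau>\<sigma>: "\<tau> (\<sigma> y) = y" if y: "y \<in> topspace Y" for y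
  proof (rule pos_sphere_separates[OF Y _ y])
    show "\<tau> (\<sigma> y) \<in> topspace Y"
      using \<sigma>(1) \<tau>(1) y by blast
    show "g (\<tau> (\<sigma> y)) \<le> g y" if g: "g \<in> pos_sphere Y" for g
    proof -
      obtain f where f: "f \<in> pos_sphere X" "g = \<Phi> f"
        using g im by blast
      have "\<sigma> y \<in> topspace X"
        using \<sigma>(1) y by blast
      then show ?thesis
        using \<sigma>(2)[OF f(1) y] \<tau>(2)[OF g, of "\<sigma> y"]
        by (simp add: isometry_inv_into(3)[OF im iso f(1)] f(2))
    qed
  qed
  have \<sigma>X: "\<sigma> y \<in> topspace X" if "y \<in> topspace Y" for y
    using \<sigma>(1) that by blast
  have \<sigma>_onto: "\<sigma> ` topspace Y = topspace X"
  proof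
    show "topspace X \<subseteq> \<sigma> ` topspace Y"
    proof
      fix x assume "x \<in> topspace X"
      then have "x = \<sigma> (\<tau> x)" "\<tau> x \<in> topspace Y"
        using \<sigma>\<tau>[of x] \<tau>(1) by auto
      then show "x \<in> \<sigma> ` topspace Y"
        by (rule image_eqI)
    qed
  qed (use \<sigma>X in blast)
  define T where "T = (\<lambda>f\<in>C0 X. \<lambda>y\<in>topspace Y. f (\<sigma> y))"
  have T_in: "T f \<in> C0 Y" if "f \<in> C0 X" for f
    using C0_composition[OF im \<sigma> that] that by (simp add: T_def)
  show ?thesis
  proof (rule ex1I[of _ T], intro conjI)
    show "T \<in> C0 X \<rightarrow>\<^sub>E C0 Y"
      using T_in by (auto simp: T_def)
    show "T ` C0 X = C0 Y"
    proof (intro equalityI subsetI)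
      fix g assume g: "g \<in> C0 Y"
      define f where "f = (\<lambda>x\<in>topspace X. g (\<tau> x))"
      have f: "f \<in> C0 X"
        unfolding f_def by (rule C0_composition[OF im' \<tau> g])
      have "T f = g"
      proof (rule extensionalityI[OF _ C0_extensional[OF g]])
        show "T f \<in> extensional (topspace Y)"
          by (rule C0_extensional[OF T_in[OF f]])
        show "T f y = g y" if "y \<in> topspace Y" for y
          using f that by (simp add: T_def f_def \<sigma>X \<tau>\<sigma>)
      qed
      with f show "g \<in> T ` C0 X"
        by blast
    qed (use T_in in auto)
    show "linear_on_C0 X Y T"
      unfolding linear_on_C0_def
    proof (intro conjI ballI allI)
      show "T (c0_add X f g) = c0_add Y (T f) (T g)" if "f \<in> C0 X" "g \<in> C0 X" for f g
        unfolding c0_add_def[of Y] using that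
        by (simp add: T_def C0_add) (rule restrict_ext, simp add: c0_add_def \<sigma>X)
      show "T (c0_scale X a f) = c0_scale Y a (T f)" if "f \<in> C0 X" for a f
        unfolding c0_scale_def[of Y] using that
        by (simp add: T_def C0_scale) (rule restrict_ext, simp add: c0_scale_def \<sigma>X)
    qed
    show "isometry_on X Y (C0 X) T"
      unfolding isometry_on_def
    proof (intro ballI)
      fix f g assume fg: "f \<in> C0 X" "g \<in> C0 X"
      have "c0_diff Y (T f) (T g) = (\<lambda>y\<in>topspace Y. c0_diff X f g (\<sigma> y))"
        unfolding c0_diff_def[of Y] using fg
        by (simp add: T_def) (rule restrict_ext, simp add: c0_diff_def \<sigma>X)
      then show "supnorm Y (c0_diff Y (T f) (T g)) = supnorm X (c0_diff X f g)"
        by (simp add: supnorm_composition[OF \<sigma>_onto])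
    qed
    show "\<forall>f\<in>pos_sphere X. T f = \<Phi> f"
    proof
      fix f assume f: "f \<in> pos_sphere X"
      then have fC: "f \<in> C0 X" and \<Phi>f: "\<Phi> f \<in> C0 Y"
        using im pos_sphere_C0 by blast+
      show "T f = \<Phi> f"
      proof (rule extensionalityI[OF C0_extensional[OF T_in[OF fC]] C0_extensional[OF \<Phi>f]])
        show "T f y = \<Phi> f y" if "y \<in> topspace Y" for y
          using fC that by (simp add: T_def \<sigma>(2)[OF f])
      qed
    qed
    then have T_sphere: "T f = \<Phi> f" if "f \<in> pos_sphere X" for f
      using that by blast
    fix S
    assume S: "S \<in> C0 X \<rightarrow>\<^sub>E C0 Y \<and> S ` C0 X = C0 Y \<and> linear_on_C0 X Y S \<and>
      isometry_on X Y (C0 X) S \<and> (\<forall>f\<in>pos_sphere X. S f = \<Phi> f)"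
    show "S = T"
    proof (rule extensionalityI[where A = "C0 X"])
      show "S \<in> extensional (C0 X)" "T \<in> extensional (C0 X)"
        using S by (simp_all add: T_def PiE_def)
      show "S f = T f" if "f \<in> C0 X" for f
      proof (rule linear_on_C0_eqI[OF _ \<open>linear_on_C0 X Y T\<close> _ that])
        show "linear_on_C0 X Y S"
          using S by blast
        show "S u = T u" if "u \<in> pos_sphere X" for u
          using S T_sphere[OF that] that by simp
      qed
    qed
  qed
qed

end
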